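(* Let $G$ and $F$ be connected graphs with no loops and no parallel edges such that $E(G)=E(F)=E$, $M_t(G)=M_t(F)$, and $M(G)\neq M(F)$. Let $X\subseteq E$ be such that $R=G[X]$ is a quasi-Hamiltonian cycle in $G$ and $F[X]$ is a spanning tree in $F$. Suppose that $G$ has exactly one spoke $s$, with its end-vertex $r$ in $R$. Then: (c1) either $F$ is isomorphic to $G$ or $F$ is a cycle; and (c2) the matroid $M_t=M_t(G)=M_t(F)$ is isomorphic to the uniform matroid $U_{m-2,m}$, where $m=|E|$ (that is, its set of bases is $\binom{E}{m-2}$, the set of all $(m-2)$-element subsets of $E$).
   Context: Graphs are finite; each edge has two distinct end-vertices. The cycle matroid $M(G)$ is the matroid on $E(G)$ whose bases are the edge sets of maximal forests of $G$. The truncation $M_t$ of a matroid $M$ with set of bases $\mathcal{B}(M)$ is the matroid on the same ground set with set of bases $\{B\setminus\{x\}: B\in\mathcal{B}(M),\ x\in B\}$; put $M_t(G)=(M(G))_t$. Equality of matroids is equality on the labelled ground set. For $X\subseteq E(G)$, $G[X]$ is the subgraph with edge set $X$ whose vertices are those incident to at least one edge in $X$. A cycle $Q$ of $G$ is quasi-Hamiltonian if $V(Q)=V(G)\setminus\{q\}$ for some $q\in V(G)$. With $R=G[X]$ a quasi-Hamiltonian cycle, let $c$ be the unique vertex of $G$ not in $R$; a spoke of $G$ is an edge of $G$ incident to $c$. *)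

theory Defs
  imports Main
begin

text \<open>Finite undirected graphs with labelled edges. Parallel edges are possible, loops are not.
  The value of \<open>ends\<close> outside the edge set is irrelevant. Two graphs on different vertex types can
  share the same edge labels, so that their cycle matroids can be compared for equality.\<close>

record ('v, 'e) ugraph =
  verts :: "'v set"
  edges :: "'e set"
  ends :: "'e \<Rightarrow> 'v set"

definition graph :: "('v, 'e) ugraph \<Rightarrow> bool" where
  "graph G \<longleftrightarrow> finite (verts G) \<and> finite (edges G) \<and>
     (\<forall>e\<in>edges G. ends G e \<subseteq> verts G \<and> card (ends G e) = 2)"

definition simple_graph :: "('v, 'e) ugraph \<Rightarrow> bool" where
  "simple_graph G \<longleftrightarrow> graph G \<and> inj_on (ends G) (edges G)"

definition connected_graph :: "('v, 'e) ugraph \<Rightarrow> bool" where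
  "connected_graph G \<longleftrightarrow> verts G \<noteq> {} \<and>
     (\<forall>u\<in>verts G. \<forall>v\<in>verts G. (u, v) \<in> {(x, y). \<exists>e\<in>edges G. ends G e = {x, y}}\<^sup>*)"

definition subgraph :: "('v, 'e) ugraph \<Rightarrow> ('v, 'e) ugraph \<Rightarrow> bool" where
  "subgraph H G \<longleftrightarrow> graph H \<and> verts H \<subseteq> verts G \<and> edges H \<subseteq> edges G \<and>
     (\<forall>e\<in>edges H. ends H e = ends G e)"

definition edge_subgraph :: "('v, 'e) ugraph \<Rightarrow> 'e set \<Rightarrow> ('v, 'e) ugraph" where
  "edge_subgraph G X = \<lparr>verts = (\<Union>e\<in>X. ends G e), edges = X, ends = ends G\<rparr>"

text \<open>A cycle of length 2 consists of two parallel edges.\<close>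

definition cycle_graph :: "('v, 'e) ugraph \<Rightarrow> bool" where
  "cycle_graph C \<longleftrightarrow> (\<exists>vs es. length vs \<ge> 2 \<and> length es = length vs \<and> distinct vs \<and> distinct es \<and>
     verts C = set vs \<and> edges C = set es \<and>
     (\<forall>i<length vs. ends C (es ! i) = {vs ! i, vs ! (Suc i mod length vs)}))"

definition forest :: "('v, 'e) ugraph \<Rightarrow> bool" where
  "forest T \<longleftrightarrow> graph T \<and> \<not> (\<exists>C. subgraph C T \<and> cycle_graph C)"

definition tree :: "('v, 'e) ugraph \<Rightarrow> bool" where
  "tree T \<longleftrightarrow> forest T \<and> connected_graph T"

definition spanning_tree :: "('v, 'e) ugraph \<Rightarrow> ('v, 'e) ugraph \<Rightarrow> bool" where
  "spanning_tree T G \<longleftrightarrow> subgraph T G \<and> tree T \<and> verts T = verts G"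

text \<open>Maximality is with respect to the subgraph preorder; it is phrased without record equality
  because that would also compare the irrelevant values of \<open>ends\<close>.\<close>

definition maximal_forest :: "('v, 'e) ugraph \<Rightarrow> ('v, 'e) ugraph \<Rightarrow> bool" where
  "maximal_forest T G \<longleftrightarrow> subgraph T G \<and> forest T \<and>
     (\<forall>T'. subgraph T' G \<and> forest T' \<and> subgraph T T' \<longrightarrow> subgraph T' T)"

definition quasi_hamiltonian :: "('v, 'e) ugraph \<Rightarrow> ('v, 'e) ugraph \<Rightarrow> bool" where
  "quasi_hamiltonian Q G \<longleftrightarrow> subgraph Q G \<and> cycle_graph Q \<and> (\<exists>q\<in>verts G. verts Q = verts G - {q})"

definition graph_isomorphic :: "('v, 'e) ugraph \<Rightarrow> ('w, 'f) ugraph \<Rightarrow> bool" where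
  "graph_isomorphic G H \<longleftrightarrow> (\<exists>f g. bij_betw f (verts G) (verts H) \<and> bij_betw g (edges G) (edges H) \<and>
     (\<forall>e\<in>edges G. ends H (g e) = f ` ends G e))"

text \<open>Matroids are presented by their ground set and their bases, so that record equality is
  equality of matroids on the labelled ground set. The matroid axioms are not part of the type.\<close>

record 'e matroid =
  ground :: "'e set"
  bases :: "'e set set"

definition cycle_matroid :: "('v, 'e) ugraph \<Rightarrow> 'e matroid" where
  "cycle_matroid G = \<lparr>ground = edges G, bases = {edges T |T. maximal_forest T G}\<rparr>"

definition truncation :: "'e matroid \<Rightarrow> 'e matroid" where
  "truncation M = \<lparr>ground = ground M, bases = {B - {x} |B x. B \<in> bases M \<and> x \<in> B}\<rparr>"

definition uniform_matroid :: "nat \<Rightarrow> nat \<Rightarrow> nat matroid" where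
  "uniform_matroid k m = \<lparr>ground = {..<m}, bases = {B. B \<subseteq> {..<m} \<and> card B = k}\<rparr>"

definition matroid_isomorphic :: "'e matroid \<Rightarrow> 'f matroid \<Rightarrow> bool" where
  "matroid_isomorphic M N \<longleftrightarrow> (\<exists>f. bij_betw f (ground M) (ground N) \<and>
     (\<forall>B. B \<subseteq> ground M \<longrightarrow> (B \<in> bases M \<longleftrightarrow> f ` B \<in> bases N)))"

end

(* A chord e of the cycle R in G gives a contradiction: in F, exchanging e for some f in the
   spanning tree X yields a basis X - f + e of M(F), so that X - f + e - x is independent in
   M_t(F) = M_t(G) for every x. But R + e contains two cycles of G through e; one of them avoids f
   and, G being simple, also some x in X - f. Hence E = X + s, the bases of M(G) are the sets
   E - z with z in X, and the bases of M_t are all (m-2)-sets. So no cycle of F misses two edges.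
   F has a cycle because E contains the spanning tree X properly. If it contains all edges, then
   F is a cycle; otherwise it misses a single edge, which is not a chord by the argument above,
   so F is a cycle with a pendant edge, just like G.

   Acyclicity is handled through the criterion that every edge of the set is a bridge. *)

theory Submission
  imports Defs
begin

section \<open>Connection and acyclic edge sets\<close>

text \<open>The relation of \<open>connected_graph\<close> with a free edge set in place of
  \<open>edges G\<close>; connectedness of \<open>F[X]\<close> thus becomes a statement about
  \<open>conn\<close> by mere unfolding.\<close>

definition adj :: "('v, 'e) ugraph \<Rightarrow> 'e set \<Rightarrow> ('v \<times> 'v) set" where
  "adj H A = {(x, y). \<exists>e\<in>A. ends H e = {x, y}}"

definition conn :: "('v, 'e) ugraph \<Rightarrow> 'e set \<Rightarrow> 'v \<Rightarrow> 'v \<Rightarrow> bool" where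
  "conn H A u v \<longleftrightarrow> (u, v) \<in> (adj H A)\<^sup>*"

text \<open>Cycles are kept as a pair of lists inside the host graph, so that no second record with
  its own \<open>ends\<close> has to be compared. The last edge closes the cycle; length 2 means two
  parallel edges.\<close>

definition cyc :: "('v, 'e) ugraph \<Rightarrow> 'v list \<Rightarrow> 'e list \<Rightarrow> bool" where
  "cyc H vs es \<longleftrightarrow> length vs \<ge> 2 \<and> length es = length vs \<and> distinct vs \<and> distinct es \<and>
     set es \<subseteq> edges H \<and>
     (\<forall>i<length vs. ends H (es ! i) = {vs ! i, vs ! (Suc i mod length vs)})"

text \<open>Independence in the cycle matroid of \<open>H\<close>; vertices do not enter, so one
  edge set can be tested in both \<open>G\<close> and \<open>F\<close>.\<close>

definition acyc :: "('v, 'e) ugraph \<Rightarrow> 'e set \<Rightarrow> bool" where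
  "acyc H A \<longleftrightarrow> A \<subseteq> edges H \<and> \<not> (\<exists>vs es. cyc H vs es \<and> set es \<subseteq> A)"

definition basis :: "('v, 'e) ugraph \<Rightarrow> 'e set \<Rightarrow> bool" where
  "basis H B \<longleftrightarrow> acyc H B \<and> (\<forall>B'. acyc H B' \<and> B \<subseteq> B' \<longrightarrow> B' = B)"

lemma conn_refl [simp]: "conn H A u u"
  by (simp add: conn_def)

lemma conn_trans: "conn H A u v \<Longrightarrow> conn H A v w \<Longrightarrow> conn H A u w"
  unfolding conn_def by (rule rtrancl_trans)

lemma conn_sym: "conn H A u v \<Longrightarrow> conn H A v u"
proof -
  have "sym (adj H A)"
    by (auto simp: sym_def adj_def insert_commute)
  then show "conn H A u v \<Longrightarrow> conn H A v u"
    unfolding conn_def by (meson sym_rtrancl symD)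
qed

lemma conn_edge: "e \<in> A \<Longrightarrow> ends H e = {u, v} \<Longrightarrow> conn H A u v"
  unfolding conn_def adj_def by auto

lemma conn_mono: "conn H A u v \<Longrightarrow> A \<subseteq> B \<Longrightarrow> conn H B u v"
proof -
  assume "A \<subseteq> B"
  then have "adj H A \<subseteq> adj H B"
    by (auto simp: adj_def)
  then show "conn H A u v \<Longrightarrow> conn H B u v"
    unfolding conn_def using rtrancl_mono by blast
qed

text \<open>A walk that uses \<open>f\<close> several times can be shortened to cross it at most
  once, in one of two directions. The induction extends this three-way alternative by one
  edge.\<close>

lemma conn_insert:
  assumes "conn H (insert f A) u v" "ends H f = {a, b}"
  shows "conn H A u v \<or> conn H A u a \<and> conn H A b v \<or> conn H A u b \<and> conn H A a v"
proof -
  have "(u, v) \<in> (adj H (insert f A))\<^sup>*"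
    using assms(1) by (simp add: conn_def)
  then show ?thesis
  proof (induction rule: rtrancl_induct)
    case base
    then show ?case by simp
  next
    case (step y z)
    then obtain e where e: "e \<in> insert f A" "ends H e = {y, z}"
      by (auto simp: adj_def)
    show ?case
    proof (cases "e \<in> A")
      case True
      then have "conn H A y z" using e conn_edge by metis
      then show ?thesis using step.IH conn_trans by metis
    next
      case False
      then have "y = a \<and> z = b \<or> y = b \<and> z = a"
        using e assms(2) by (auto simp: doubleton_eq_iff)
      then show ?thesis using step.IH conn_refl conn_trans conn_sym by metis
    qed
  qed
qed

text \<open>The tool for refuting a connection: exhibit a set \<open>S\<close> that no edge of
  \<open>A\<close> leaves.\<close>

lemma conn_closed:
  assumes "conn H A u v" "u \<in> S" "\<And>e. e \<in> A \<Longrightarrow> ends H e \<subseteq> S \<or> ends H e \<inter> S = {}"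
  shows "v \<in> S"
proof -
  have "(u, v) \<in> (adj H A)\<^sup>*"
    using assms(1) by (simp add: conn_def)
  then show ?thesis
  proof (induction rule: rtrancl_induct)
    case base
    then show ?case using assms(2) .
  next
    case (step y z)
    then obtain e where e: "e \<in> A" "ends H e = {y, z}"
      by (auto simp: adj_def)
    with assms(3)[OF e(1)] step.IH show ?case by auto
  qed
qed

lemma conn_nth:
  assumes "\<And>i. l \<le> i \<Longrightarrow> i < h \<Longrightarrow> \<exists>e\<in>A. ends H e = {vs ! i, vs ! Suc i}"
    and "l \<le> i" "i \<le> j" "j \<le> h"
  shows "conn H A (vs ! i) (vs ! j)"
  using assms(3,4)
proof (induction j rule: dec_induct)
  case base
  then show ?case by simp
next
  case (step n)
  obtain e where "e \<in> A" "ends H e = {vs ! n, vs ! Suc n}"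
    using assms(1)[of n] assms(2) step by auto
  then show ?case using step conn_edge conn_trans by (metis Suc_leD)
qed

text \<open>A walk is turned into a path during the induction: if the next vertex already occurs,
  the path is cut back to that occurrence.\<close>

lemma conn_path:
  assumes "conn H A u v"
  shows "\<exists>vs es. vs \<noteq> [] \<and> hd vs = u \<and> last vs = v \<and> distinct vs \<and> length vs = Suc (length es) \<and>
    set es \<subseteq> A \<and> (\<forall>i<length es. ends H (es ! i) = {vs ! i, vs ! Suc i})"
proof -
  have "(u, v) \<in> (adj H A)\<^sup>*"
    using assms by (simp add: conn_def)
  then show ?thesis
  proof (induction rule: rtrancl_induct)
    case base
    have "[u] \<noteq> [] \<and> hd [u] = u \<and> last [u] = u \<and> distinct [u] \<and> length [u] = Suc (length ([]::'b list)) \<and>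
      set ([]::'b list) \<subseteq> A \<and> (\<forall>i<length ([]::'b list). ends H ([] ! i) = {[u] ! i, [u] ! Suc i})"
      by simp
    then show ?case by blast
  next
    case (step y z)
    then obtain e where e: "e \<in> A" "ends H e = {y, z}"
      by (auto simp: adj_def)
    obtain vs es where p: "vs \<noteq> []" "hd vs = u" "last vs = y" "distinct vs" "length vs = Suc (length es)"
      "set es \<subseteq> A" "\<forall>i<length es. ends H (es ! i) = {vs ! i, vs ! Suc i}"
      using step.IH by blast
    show ?case
    proof (cases "z \<in> set vs")
      case True
      then obtain k where k: "k < length vs" "vs ! k = z"
        by (auto simp: in_set_conv_nth)
      have "last (take (Suc k) vs) = z"
        using k by (simp add: take_Suc_conv_app_nth)
      moreover have "hd (take (Suc k) vs) = u"
        using p by simp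
      moreover have "set (take k es) \<subseteq> A"
        using p(6) set_take_subset by fastforce
      ultimately show ?thesis
        using p k by (intro exI[of _ "take (Suc k) vs"] exI[of _ "take k es"]) auto
    next
      case False
      have "ends H ((es @ [e]) ! i) = {(vs @ [z]) ! i, (vs @ [z]) ! Suc i}" if "i < length (es @ [e])" for i
      proof (cases "i < length es")
        case True
        then show ?thesis using p by (simp add: nth_append)
      next
        case False
        then have "i = length es" using that by simp
        then show ?thesis using p e by (simp add: nth_append last_conv_nth)
      qed
      then show ?thesis
        using p e False by (intro exI[of _ "vs @ [z]"] exI[of _ "es @ [e]"]) auto
    qed
  qed
qed

lemma acyc_subset: "acyc H A \<Longrightarrow> B \<subseteq> A \<Longrightarrow> acyc H B"
  unfolding acyc_def by blast

lemma graph_ends: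
  assumes "graph H" "e \<in> edges H"
  obtains u v where "ends H e = {u, v}" "u \<noteq> v" "u \<in> verts H" "v \<in> verts H"
proof -
  have "card (ends H e) = 2" "ends H e \<subseteq> verts H"
    using assms by (auto simp: graph_def)
  then show thesis using that by (auto simp: card_2_iff)
qed

text \<open>A path between the ends of \<open>e\<close> that avoids \<open>e\<close> would be closed
  to a cycle by \<open>e\<close>. With \<open>acycI\<close> this makes acyclicity equivalent to
  every edge being a bridge.\<close>

lemma acyc_not_conn:
  assumes "graph H" "acyc H A" "e \<in> A" "ends H e = {u, v}"
  shows "\<not> conn H (A - {e}) u v"
proof
  assume "conn H (A - {e}) u v"
  then obtain vs es where p: "vs \<noteq> []" "hd vs = u" "last vs = v" "distinct vs"
      "length vs = Suc (length es)" "set es \<subseteq> A - {e}"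
      "\<forall>i<length es. ends H (es ! i) = {vs ! i, vs ! Suc i}"
    by (metis conn_path)
  have AE: "A \<subseteq> edges H" using assms(2) by (simp add: acyc_def)
  have uv: "u \<noteq> v"
    using graph_ends[OF assms(1)] AE assms(3,4)
    by (metis doubleton_eq_iff subsetD)
  \<comment> \<open>As \<open>u\<close> and \<open>v\<close> differ, the path has an edge, so the
    closed sequence has the required length of at least 2.\<close>
  have len: "length es \<ge> 1"
    using p uv by (cases vs; cases es) auto
  \<comment> \<open>A repeated edge would give two consecutive vertex pairs that coincide, which
    distinct vertices exclude.\<close>
  have de: "distinct es"
    unfolding distinct_conv_nth
  proof (intro allI impI)
    fix i j assume ij: "i < length es" "j < length es" "i \<noteq> j"
    show "es ! i \<noteq> es ! j"
    proof
      assume "es ! i = es ! j"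
      then have "{vs ! i, vs ! Suc i} = {vs ! j, vs ! Suc j}"
        using p(7) ij by metis
      then show False
        using ij p(4,5) by (auto simp: doubleton_eq_iff nth_eq_iff_index_eq)
    qed
  qed
  have "cyc H vs (es @ [e])"
    unfolding cyc_def
  proof (intro conjI allI impI)
    show "2 \<le> length vs" "length (es @ [e]) = length vs" "distinct vs"
      using p len by auto
    show "distinct (es @ [e])" using de p(6) by auto
    show "set (es @ [e]) \<subseteq> edges H" using p(6) AE assms(3) by auto
    fix i assume i: "i < length vs"
    show "ends H ((es @ [e]) ! i) = {vs ! i, vs ! (Suc i mod length vs)}"
    proof (cases "i < length es")
      case True
      then show ?thesis using p by (simp add: nth_append)
    next
      case False
      then have "i = length es" using i p(5) by simp
      then show ?thesis
        using p assms(4) by (simp add: nth_append last_conv_nth hd_conv_nth insert_commute)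
    qed
  qed
  moreover have "set (es @ [e]) \<subseteq> A" using p(6) assms(3) by auto
  ultimately show False using assms(2) unfolding acyc_def by blast
qed

text \<open>In a cycle the closing edge, at index \<open>k\<close>, is not a bridge: the remaining
  edges form a path between its ends.\<close>

lemma acycI:
  assumes "A \<subseteq> edges H" "\<And>e u v. e \<in> A \<Longrightarrow> ends H e = {u, v} \<Longrightarrow> \<not> conn H (A - {e}) u v"
  shows "acyc H A"
  unfolding acyc_def
proof (intro conjI notI assms(1))
  assume "\<exists>vs es. cyc H vs es \<and> set es \<subseteq> A"
  then obtain vs es where c: "cyc H vs es" "set es \<subseteq> A" by blast
  define k where "k = length vs - 1"
  have k: "length vs = Suc k" "length es = Suc k" "distinct es"
    using c(1) by (auto simp: cyc_def k_def)
  have "ends H (es ! k) = {vs ! 0, vs ! k}"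
    using c(1) k by (auto simp: cyc_def)
  moreover have "conn H (A - {es ! k}) (vs ! 0) (vs ! k)"
  proof (rule conn_nth[of 0 k])
    fix i assume i: "i < k"
    then have "es ! i \<in> A - {es ! k}"
      using k c(2) by (auto simp: nth_eq_iff_index_eq)
    moreover have "ends H (es ! i) = {vs ! i, vs ! Suc i}"
      using c(1) k i by (auto simp: cyc_def)
    ultimately show "\<exists>e\<in>A - {es ! k}. ends H e = {vs ! i, vs ! Suc i}" by blast
  qed auto
  moreover have "es ! k \<in> A" using k c(2) by auto
  ultimately show False using assms(2) by blast
qed

section \<open>Bases of the cycle matroid\<close>

lemma cyc_cycle_graph:
  assumes "graph H" "cyc H vs es"
  shows "subgraph \<lparr>verts = set vs, edges = set es, ends = ends H\<rparr> H"
    and "cycle_graph \<lparr>verts = set vs, edges = set es, ends = ends H\<rparr>"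
proof -
  let ?C = "\<lparr>verts = set vs, edges = set es, ends = ends H\<rparr>"
  have e: "ends H e \<subseteq> set vs" if e: "e \<in> set es" for e
  proof -
    have l: "length es = length vs" using assms(2) by (simp add: cyc_def)
    obtain i where i: "i < length vs" "e = es ! i"
      using e unfolding in_set_conv_nth l by blast
    then have "Suc i mod length vs < length vs" by (intro mod_less_divisor) linarith
    moreover have "ends H e = {vs ! i, vs ! (Suc i mod length vs)}"
      using assms(2) i by (simp add: cyc_def)
    ultimately show ?thesis using i by simp
  qed
  have v: "set vs \<subseteq> verts H"
  proof
    fix x assume "x \<in> set vs"
    then obtain i where i: "i < length vs" "x = vs ! i"
      by (auto simp: in_set_conv_nth)
    then have "x \<in> ends H (es ! i)" "es ! i \<in> edges H"
      using assms(2) by (auto simp: cyc_def)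
    then show "x \<in> verts H" using assms(1) by (auto simp: graph_def)
  qed
  show "subgraph ?C H"
    using e v assms unfolding subgraph_def graph_def cyc_def by auto
  show "cycle_graph ?C"
    using assms(2) unfolding cycle_graph_def cyc_def by auto
qed

lemma cycle_graph_cyc:
  assumes "subgraph C H" "cycle_graph C"
  obtains vs es where "cyc H vs es" "edges C = set es" "verts C = set vs"
proof -
  obtain vs es where c: "length vs \<ge> 2" "length es = length vs" "distinct vs" "distinct es"
     "verts C = set vs" "edges C = set es"
     "\<forall>i<length vs. ends C (es ! i) = {vs ! i, vs ! (Suc i mod length vs)}"
    using assms(2) unfolding cycle_graph_def by blast
  have "ends C (es ! i) = ends H (es ! i)" if "i < length vs" for i
    using assms(1) c(2,6) that by (auto simp: subgraph_def)
  then have "cyc H vs es"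
    using c assms(1) unfolding cyc_def subgraph_def by auto
  then show thesis using that c by blast
qed

text \<open>The cycles of \<open>T\<close> are exactly the cycles of \<open>H\<close> whose edges
  lie in \<open>T\<close>, because the two graphs agree on the ends of these edges.\<close>

lemma forest_iff_acyc:
  assumes "subgraph T H" "graph H"
  shows "forest T \<longleftrightarrow> acyc H (edges T)"
proof -
  have "(\<exists>C. subgraph C T \<and> cycle_graph C) \<longleftrightarrow> (\<exists>vs es. cyc H vs es \<and> set es \<subseteq> edges T)"
  proof
    assume "\<exists>C. subgraph C T \<and> cycle_graph C"
    then obtain C where C: "subgraph C T" "cycle_graph C" by blast
    then have "subgraph C H"
      using assms(1) unfolding subgraph_def by auto
    with C show "\<exists>vs es. cyc H vs es \<and> set es \<subseteq> edges T"
      by (metis cycle_graph_cyc subgraph_def)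
  next
    assume "\<exists>vs es. cyc H vs es \<and> set es \<subseteq> edges T"
    then obtain vs es where c: "cyc H vs es" "set es \<subseteq> edges T" by blast
    have "cyc T vs es"
      using c assms(1) unfolding cyc_def subgraph_def
      by (metis nth_mem subsetD)
    then show "\<exists>C. subgraph C T \<and> cycle_graph C"
      using cyc_cycle_graph assms(1) unfolding subgraph_def by metis
  qed
  then show ?thesis
    using assms unfolding forest_def acyc_def subgraph_def by blast
qed

lemma spanning_subgraph:
  assumes "graph H" "B \<subseteq> edges H"
  shows "subgraph \<lparr>verts = verts H, edges = B, ends = ends H\<rparr> H"
  using assms unfolding subgraph_def graph_def by (auto intro: finite_subset)

lemma bases_cycle_matroid:
  assumes "graph H"
  shows "bases (cycle_matroid H) = {B. basis H B}"
proof -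
  have "(\<exists>T. B = edges T \<and> maximal_forest T H) \<longleftrightarrow> basis H B" for B
  proof
    assume "\<exists>T. B = edges T \<and> maximal_forest T H"
    then obtain T where T: "B = edges T" "maximal_forest T H" by blast
    then have s: "subgraph T H" "forest T" by (auto simp: maximal_forest_def)
    show "basis H B"
      unfolding basis_def
    proof (intro conjI allI impI)
      show "acyc H B" using s T forest_iff_acyc assms by blast
      fix B' assume B': "acyc H B' \<and> B \<subseteq> B'"
      let ?T = "\<lparr>verts = verts H, edges = B', ends = ends H\<rparr>"
      have t: "subgraph ?T H"
        using B' assms spanning_subgraph by (auto simp: acyc_def)
      have "forest ?T" using forest_iff_acyc[OF t assms] B' by simp
      moreover have "subgraph T ?T"
        using s B' T(1) by (auto simp: subgraph_def)
      ultimately have "subgraph ?T T"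
        using T(2) t unfolding maximal_forest_def by blast
      then show "B' = B" using B' T(1) by (auto simp: subgraph_def)
    qed
  next
    assume b: "basis H B"
    \<comment> \<open>All vertices are included, since maximality in the subgraph order also
      concerns vertices that meet no edge of \<open>B\<close>.\<close>
    let ?T = "\<lparr>verts = verts H, edges = B, ends = ends H\<rparr>"
    have t: "subgraph ?T H"
      using b assms spanning_subgraph by (auto simp: basis_def acyc_def)
    have "forest ?T"
      using forest_iff_acyc[OF t assms] b by (simp add: basis_def)
    moreover have "subgraph T' ?T" if "subgraph T' H" "forest T'" "subgraph ?T T'" for T'
    proof -
      have "acyc H (edges T')" using forest_iff_acyc that assms by blast
      moreover have "B \<subseteq> edges T'" using that(3) by (simp add: subgraph_def)
      ultimately have "edges T' = B" using b by (auto simp: basis_def)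
      then show ?thesis using that(1) by (auto simp: subgraph_def)
    qed
    ultimately have "maximal_forest ?T H" using t by (auto simp: maximal_forest_def)
    then show "\<exists>T. B = edges T \<and> maximal_forest T H"
      by (intro exI[of _ ?T]) simp
  qed
  then show ?thesis unfolding cycle_matroid_def by auto
qed

lemma bases_truncation:
  assumes "graph H"
  shows "bases (truncation (cycle_matroid H)) = {B - {x} |B x. basis H B \<and> x \<in> B}"
  using bases_cycle_matroid[OF assms] by (simp add: truncation_def)

lemma acyc_truncation:
  assumes "graph H" "B \<in> bases (truncation (cycle_matroid H))"
  shows "acyc H B"
proof -
  obtain A x where "B = A - {x}" "basis H A"
    using assms(2) unfolding bases_truncation[OF assms(1)] by blast
  then show ?thesis using acyc_subset[of H A B] by (simp add: basis_def)
qed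

text \<open>An additional edge of a larger acyclic set would have ends that are already connected
  through \<open>B\<close>, so it would not be a bridge.\<close>

lemma basisI:
  assumes "graph H" "acyc H B" "\<And>u v. u \<in> verts H \<Longrightarrow> v \<in> verts H \<Longrightarrow> conn H B u v"
  shows "basis H B"
  unfolding basis_def
proof (intro conjI allI impI assms(2))
  fix B' assume B': "acyc H B' \<and> B \<subseteq> B'"
  show "B' = B"
  proof (rule ccontr)
    assume "B' \<noteq> B"
    then obtain e where e: "e \<in> B'" "e \<notin> B" using B' by blast
    then obtain u v where uv: "ends H e = {u, v}" "u \<in> verts H" "v \<in> verts H"
      using B' graph_ends[OF assms(1)] unfolding acyc_def by (metis subsetD)
    have "B \<subseteq> B' - {e}" using B' e by blast
    then have "conn H (B' - {e}) u v"
      using conn_mono[OF assms(3)[OF uv(2,3)]] by blast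
    then show False using acyc_not_conn[OF assms(1)] B' e uv by blast
  qed
qed

text \<open>The edge \<open>e\<close> closes a cycle with the tree \<open>X\<close>, and any tree
  edge \<open>f\<close> on that cycle can be traded for \<open>e\<close>.\<close>

lemma spanning_tree_exchange:
  assumes H: "graph H" and X: "acyc H X"
    and conn: "\<And>u v. u \<in> verts H \<Longrightarrow> v \<in> verts H \<Longrightarrow> conn H X u v"
    and e: "e \<in> edges H" "e \<notin> X"
  obtains f where "f \<in> X" "basis H (insert e (X - {f}))"
proof -
  obtain u v where uv: "ends H e = {u, v}" "u \<noteq> v" "u \<in> verts H" "v \<in> verts H"
    using graph_ends[OF H e(1)] by blast
  have XE: "X \<subseteq> edges H" using X by (simp add: acyc_def)
  have finX: "finite X" using H XE finite_subset by (auto simp: graph_def)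
  \<comment> \<open>A minimal member of this family is the tree path between the ends of
    \<open>e\<close>; minimality makes each of its edges indispensable.\<close>
  define \<A> where "\<A> = {A. A \<subseteq> X \<and> conn H A u v}"
  have "finite \<A>" "X \<in> \<A>"
    using finX conn[OF uv(3,4)] by (auto simp: \<A>_def)
  then obtain A where "A \<in> \<A>" "\<forall>B\<in>\<A>. B \<subseteq> A \<longrightarrow> A = B"
    using finite_has_minimal[of \<A>] by blast
  then have A: "A \<subseteq> X" "conn H A u v"
      "\<And>B. B \<subseteq> X \<Longrightarrow> conn H B u v \<Longrightarrow> B \<subseteq> A \<Longrightarrow> A = B"
    by (simp_all add: \<A>_def)
  have "A \<noteq> {}"
  proof
    assume "A = {}"
    then have "v \<in> {u}" using A(2) by (intro conn_closed[of H A u v]) auto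
    then show False using uv by simp
  qed
  then obtain f where f: "f \<in> A" by blast
  obtain a b where ab: "ends H f = {a, b}"
    using graph_ends[OF H] f A(1) XE by (metis subsetD)
  have "\<not> conn H (A - {f}) u v"
    using A(3)[of "A - {f}"] A(1) f by blast
  moreover have "insert f (A - {f}) = A" using f by blast
  ultimately have "conn H (A - {f}) u a \<and> conn H (A - {f}) b v \<or>
      conn H (A - {f}) u b \<and> conn H (A - {f}) a v"
    using conn_insert[of H f "A - {f}" u v a b] A(2) ab by auto
  then have uavb: "conn H (X - {f}) u a \<and> conn H (X - {f}) b v \<or>
      conn H (X - {f}) u b \<and> conn H (X - {f}) a v"
    using conn_mono[where H = H, OF _ Diff_mono[OF A(1) order_refl, of "{f}"]] by auto
  have nab: "\<not> conn H (X - {f}) a b"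
    using acyc_not_conn[OF H X _ ab] f A(1) by blast
  \<comment> \<open>If \<open>u\<close> and \<open>v\<close> were connected without
    \<open>f\<close>, then so would be the ends of \<open>f\<close>, against \<open>f\<close> being
    a bridge of \<open>X\<close>.\<close>
  have nuv: "\<not> conn H (X - {f}) u v"
    using uavb nab conn_trans conn_sym by metis
  let ?Y = "insert e (X - {f})"
  have XY: "conn H ?Y x y" if "conn H (X - {f}) x y" for x y
    using that by (rule conn_mono) blast
  have Yab: "conn H ?Y a b"
  proof -
    have "conn H ?Y u v" using conn_edge uv by (metis insertI1)
    moreover have "conn H ?Y u a \<and> conn H ?Y b v \<or> conn H ?Y u b \<and> conn H ?Y a v"
      using uavb XY by blast
    ultimately show ?thesis using conn_trans conn_sym by metis
  qed
  have "basis H ?Y"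
  proof (rule basisI[OF H])
    show "acyc H ?Y"
    proof (rule acycI)
      show "?Y \<subseteq> edges H" using XE e by blast
      fix g p q assume g: "g \<in> ?Y" "ends H g = {p, q}"
      show "\<not> conn H (?Y - {g}) p q"
      proof (cases "g = e")
        case True
        then have "?Y - {g} = X - {f}" using e by blast
        moreover have "p = u \<and> q = v \<or> p = v \<and> q = u"
          using True g(2) uv(1) by (auto simp: doubleton_eq_iff)
        ultimately show ?thesis using nuv conn_sym by metis
      next
        case False
        then have gX: "g \<in> X - {f}" using g by blast
        show ?thesis
        proof
          \<comment> \<open>A connection of \<open>p\<close> and \<open>q\<close> avoiding
            \<open>g\<close> has to run through \<open>e\<close>; its two remaining pieces together
            with \<open>g\<close> would connect \<open>u\<close> and \<open>v\<close> inside
            \<open>X - {f}\<close>.\<close>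
          let ?Z = "X - {f} - {g}"
          assume "conn H (?Y - {g}) p q"
          moreover have "?Y - {g} = insert e ?Z" using False by blast
          ultimately have "conn H ?Z p q \<or> conn H ?Z p u \<and> conn H ?Z v q \<or>
              conn H ?Z p v \<and> conn H ?Z u q"
            using conn_insert[of H e ?Z p q u v] uv(1) by auto
          moreover have "\<not> conn H ?Z p q"
            using acyc_not_conn[OF H acyc_subset[OF X] gX g(2)] by blast
          moreover have "conn H (X - {f}) p q" using conn_edge gX g(2) by metis
          moreover have "conn H ?Z x y \<Longrightarrow> conn H (X - {f}) x y" for x y
            using conn_mono by (metis Diff_subset)
          ultimately show False using nuv conn_trans conn_sym by metis
        qed
      qed
    qed
    fix x y assume "x \<in> verts H" "y \<in> verts H"
    then have "conn H X x y" using conn by blast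
    \<comment> \<open>A connection in \<open>X\<close> that uses \<open>f\<close> is rerouted
      through \<open>e\<close> by means of \<open>Yab\<close>.\<close>
    moreover have "insert f (X - {f}) = X" using f A(1) by blast
    ultimately consider "conn H (X - {f}) x y" | "conn H (X - {f}) x a" "conn H (X - {f}) b y"
      | "conn H (X - {f}) x b" "conn H (X - {f}) a y"
      using conn_insert[of H f "X - {f}" x y a b] ab by auto
    then show "conn H ?Y x y"
    proof cases
      case 1
      then show ?thesis by (rule XY)
    next
      case 2
      then show ?thesis using conn_trans[OF conn_trans[OF XY Yab] XY] by blast
    next
      case 3
      then show ?thesis using conn_trans[OF conn_trans[OF XY conn_sym[OF Yab]] XY] by blast
    qed
  qed
  then show thesis using that f A(1) by blast
qed

section \<open>Cycles with a chord or a pendant edge\<close>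

lemma cyc_rotate:
  assumes "cyc H vs es"
  shows "cyc H (rotate n vs) (rotate n es)"
proof -
  let ?k = "length vs"
  have l: "length es = ?k" "?k \<ge> 2" using assms by (auto simp: cyc_def)
  have "ends H (rotate n es ! i) = {rotate n vs ! i, rotate n vs ! (Suc i mod ?k)}" if "i < ?k" for i
  proof -
    have m: "(n + i) mod ?k < ?k" "Suc i mod ?k < ?k" using l by (auto intro: mod_less_divisor)
    have "(n + Suc i mod ?k) mod ?k = Suc ((n + i) mod ?k) mod ?k"
      by (simp add: mod_simps)
    then show ?thesis
      using assms m that l by (simp add: cyc_def nth_rotate)
  qed
  then show ?thesis using assms by (simp add: cyc_def)
qed

lemma cyc_starting_at_vertex:
  assumes "cyc H vs es" "x \<in> set vs"
  obtains vs' es' where "cyc H vs' es'" "set vs' = set vs" "set es' = set es" "vs' ! 0 = x"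
proof -
  obtain i where i: "i < length vs" "vs ! i = x"
    using assms(2) by (auto simp: in_set_conv_nth)
  then have "rotate i vs ! 0 = x"
    using nth_rotate[of 0 vs i] by (cases vs) auto
  then show thesis
    using that[of "rotate i vs" "rotate i es"] cyc_rotate[OF assms(1)] by simp
qed

text \<open>Once \<open>f\<close> is the closing edge, the other edges form a path in list order,
  and indices can be compared without reduction modulo the length.\<close>

lemma cyc_ending_at_edge:
  assumes "cyc H vs es" "f \<in> set es"
  obtains vs' es' where "cyc H vs' es'" "set vs' = set vs" "set es' = set es"
    "es' ! (length vs' - 1) = f"
proof -
  have l: "length es = length vs" "length vs \<ge> 2" using assms by (auto simp: cyc_def)
  obtain i where i: "i < length vs" "es ! i = f"
    using assms(2) l by (auto simp: in_set_conv_nth)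
  \<comment> \<open>Rotation by \<open>Suc i\<close>, not by \<open>i\<close>, moves the edge of
    index \<open>i\<close> to the last position.\<close>
  have "Suc i + (length vs - 1) = i + length vs" using i by simp
  then have "(Suc i + (length vs - 1)) mod length vs = i"
    using i by simp
  then have "rotate (Suc i) es ! (length vs - 1) = f"
    using nth_rotate[of "length vs - 1" es "Suc i"] l i by auto
  then show thesis
    using that[of "rotate (Suc i) vs" "rotate (Suc i) es"] cyc_rotate[OF assms(1), of "Suc i"]
    by (simp del: rotate_Suc)
qed

text \<open>The cycle minus \<open>f\<close> is a path containing both ends of the chord
  \<open>e\<close>. The segment between them forms a cycle with \<open>e\<close>, and as
  \<open>e\<close> is not parallel to \<open>f\<close>, the segment leaves out a further edge
  \<open>x\<close>.\<close>

lemma cyc_chord: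
  assumes H: "simple_graph H" and c: "cyc H vs es" and f: "f \<in> set es"
    and e: "e \<in> edges H" "e \<notin> set es" "ends H e \<subseteq> set vs"
  obtains x where "x \<in> set es - {f}" "\<not> acyc H (insert e (set es - {f, x}))"
proof -
  have gH: "graph H" using H by (simp add: simple_graph_def)
  obtain ws ds where w: "cyc H ws ds" "set ws = set vs" "set ds = set es" "ds ! (length ws - 1) = f"
    using cyc_ending_at_edge[OF c f] by blast
  define k where "k = length ws - 1"
  have k: "length ws = Suc k" "length ds = Suc k" "distinct ds" "distinct ws" "k \<ge> 1" "ds ! k = f"
    using w by (auto simp: cyc_def k_def)
  have endsi: "ends H (ds ! i) = {ws ! i, ws ! Suc i}" if "i < k" for i
    using w(1) k that by (auto simp: cyc_def)
  have endsf: "ends H f = {ws ! k, ws ! 0}"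
    using w(1) k by (auto simp: cyc_def)
  obtain a b where ab: "ends H e = {a, b}" "a \<noteq> b"
    using graph_ends[OF gH e(1)] by blast
  obtain i0 j0 where ij0: "i0 \<le> k" "j0 \<le> k" "ws ! i0 = a" "ws ! j0 = b"
    using ab e(3) w(2) k by (metis in_set_conv_nth insert_subset less_Suc_eq_le)
  have "\<exists>i j. i < j \<and> j \<le> k \<and> ends H e = {ws ! i, ws ! j}"
  proof (cases "i0 < j0")
    case True
    then show ?thesis using ij0 ab by metis
  next
    case False
    then have "j0 < i0" using ij0 ab by (metis linorder_neqE_nat)
    then show ?thesis using ij0 ab by (metis insert_commute)
  qed
  then obtain i j where ij: "i < j" "j \<le> k" "ends H e = {ws ! i, ws ! j}" by blast
  \<comment> \<open>Simplicity enters here: a chord joining the two ends of the path would be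
    parallel to \<open>f\<close>.\<close>
  have nij: "\<not> (i = 0 \<and> j = k)"
  proof
    assume "i = 0 \<and> j = k"
    then have "ends H e = ends H f" using endsf ij by (simp add: insert_commute)
    moreover have "f \<in> edges H" using c f by (auto simp: cyc_def)
    ultimately have "e = f"
      using H e(1) by (auto simp: simple_graph_def dest: inj_onD)
    then show False using e f by simp
  qed
  \<comment> \<open>The position of a path edge outside the segment with edge indices
    \<open>i\<close> to \<open>j - 1\<close>: the first path edge, or the last one, at
    \<open>k - 1\<close>, if the segment starts at 0.\<close>
  define d where "d = (if i = 0 then k - 1 else 0)"
  have d: "d < k" "\<not> (i \<le> d \<and> d < j)" using nij ij k by (auto simp: d_def)
  have dd: "ds ! d \<in> set es - {f}"
  proof -
    have "ds ! d \<noteq> ds ! k" using d(1) k(2,3) by (simp add: nth_eq_iff_index_eq)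
    moreover have "ds ! d \<in> set ds" using d(1) k(2) by simp
    ultimately show ?thesis using w(3) k(6) by simp
  qed
  have "conn H (set es - {f, ds ! d}) (ws ! i) (ws ! j)"
  proof (rule conn_nth[of i j])
    fix l assume l: "i \<le> l" "l < j"
    then have "ds ! l \<in> set es - {f, ds ! d}"
      using d k ij w(3) by (auto simp: nth_eq_iff_index_eq simp flip: k(6))
    moreover have "ends H (ds ! l) = {ws ! l, ws ! Suc l}" using endsi l ij by simp
    ultimately show "\<exists>e\<in>set es - {f, ds ! d}. ends H e = {ws ! l, ws ! Suc l}" by blast
  qed (use ij in auto)
  moreover have "insert e (set es - {f, ds ! d}) - {e} = set es - {f, ds ! d}" using e by blast
  ultimately have "\<not> acyc H (insert e (set es - {f, ds ! d}))"
    using acyc_not_conn[OF gH _ insertI1 ij(3)] by metis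
  then show thesis using that dd by blast
qed

text \<open>Removing \<open>z\<close> leaves a path through all vertices of the cycle, and
  \<open>s\<close> attaches the only other vertex \<open>p\<close>; the result is a spanning
  tree.\<close>

lemma cyc_pendant_basis:
  assumes H: "graph H" and c: "cyc H vs es" and z: "z \<in> set es"
    and V: "verts H = insert p (set vs)" "p \<notin> set vs"
    and s: "s \<in> edges H" "ends H s = {p, r}" "r \<in> set vs"
  shows "basis H (insert s (set es - {z}))"
proof -
  obtain ws ds where w: "cyc H ws ds" "set ws = set vs" "set ds = set es" "ds ! (length ws - 1) = z"
    using cyc_ending_at_edge[OF c z] by blast
  define k where "k = length ws - 1"
  have k: "length ws = Suc k" "length ds = Suc k" "distinct ds" "distinct ws" "k \<ge> 1" "ds ! k = z"
    using w by (auto simp: cyc_def k_def)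
  have endsi: "ends H (ds ! i) = {ws ! i, ws ! Suc i}" if "i < k" for i
    using w(1) k that by (auto simp: cyc_def)
  have edges: "\<exists>i<k. d = ds ! i" if "d \<in> set es - {z}" for d
    using that w(3) k by (metis Diff_iff in_set_conv_nth less_SucE singletonI)
  have ends_ds: "ends H d \<subseteq> set vs" if "d \<in> set es - {z}" for d
    using edges[OF that] endsi w(2) k by (metis Suc_mono empty_subsetI insert_subset less_SucI nth_mem)
  have sn: "s \<notin> set es - {z}" using ends_ds s V by blast
  let ?Y = "insert s (set es - {z})"
  show ?thesis
  proof (rule basisI[OF H])
    show "acyc H ?Y"
    proof (rule acycI)
      show "?Y \<subseteq> edges H" using s c by (auto simp: cyc_def)
      fix g a b assume g: "g \<in> ?Y" "ends H g = {a, b}"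
      show "\<not> conn H (?Y - {g}) a b"
      proof (cases "g = s")
        case True
        \<comment> \<open>Without \<open>s\<close> no edge meets \<open>p\<close>, so
          \<open>{p}\<close> is closed.\<close>
        have "\<not> conn H (set es - {z}) p r"
        proof
          assume "conn H (set es - {z}) p r"
          then have "r \<in> {p}"
            by (rule conn_closed) (use ends_ds V in auto)
          then show False using s V by blast
        qed
        moreover have "a = p \<and> b = r \<or> a = r \<and> b = p"
          using True g(2) s(2) by (auto simp: doubleton_eq_iff)
        moreover have "?Y - {g} = set es - {z}" using True sn by blast
        ultimately show ?thesis using conn_sym by metis
      next
        case False
        then obtain i where i: "i < k" "g = ds ! i" using g edges by blast
        \<comment> \<open>The initial part of the path up to the edge \<open>g\<close>. In
          \<open>S\<close> the pendant vertex joins the side of \<open>r\<close>, so that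
          \<open>s\<close> does not cross the cut and \<open>g\<close> is the only edge that
          does.\<close>
        define P where "P = {ws ! j |j. j \<le> i}"
        define S where "S = (if r \<in> P then insert p P else P)"
        have PV: "P \<subseteq> set vs"
        proof
          fix x assume "x \<in> P"
          then obtain j where "j \<le> i" "x = ws ! j" by (auto simp: P_def)
          then have "x \<in> set ws" using i k(1) by simp
          then show "x \<in> set vs" using w(2) by simp
        qed
        have inP: "ws ! j \<in> P \<longleftrightarrow> j \<le> i" if "j \<le> k" for j
        proof -
          have "j = j'" if "j' \<le> i" "ws ! j = ws ! j'" for j'
            using that \<open>j \<le> k\<close> i(1) k(1,4) by (simp add: nth_eq_iff_index_eq)
          then show ?thesis unfolding P_def by blast
        qed
        have inS: "ws ! j \<in> S \<longleftrightarrow> j \<le> i" if "j \<le> k" for j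
        proof -
          have "ws ! j \<in> set vs" using that w(2) k by (metis le_imp_less_Suc nth_mem)
          then show ?thesis using inP[OF that] V by (auto simp: S_def)
        qed
        have closed: "ends H d \<subseteq> S \<or> ends H d \<inter> S = {}" if d: "d \<in> ?Y - {g}" for d
        proof (cases "d = s")
          case True
          then show ?thesis using s(2) PV V s(3) by (auto simp: S_def)
        next
          case False
          then obtain j where j: "j < k" "d = ds ! j" using d edges by blast
          then have "j \<noteq> i" using d i by auto
          then show ?thesis using endsi[OF j(1)] j inS[of j] inS[of "Suc j"] by auto
        qed
        have "\<not> conn H (?Y - {g}) (ws ! i) (ws ! Suc i)"
          using conn_closed[OF _ _ closed] inS[of i] inS[of "Suc i"] i by auto
        moreover have "a = ws ! i \<and> b = ws ! Suc i \<or> a = ws ! Suc i \<and> b = ws ! i"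
          using g(2) endsi i by (auto simp: doubleton_eq_iff)
        ultimately show ?thesis using conn_sym by metis
      qed
    qed
    have c0: "conn H ?Y (ws ! 0) (ws ! j)" if "j \<le> k" for j
    proof (rule conn_nth[of 0 k])
      fix l assume l: "l < k"
      then have "ds ! l \<noteq> ds ! k" using k(2,3) by (simp add: nth_eq_iff_index_eq)
      moreover have "ds ! l \<in> set ds" using l k(2) by simp
      ultimately have "ds ! l \<in> set es - {z}" using w(3) k(6) by simp
      then show "\<exists>e\<in>?Y. ends H e = {ws ! l, ws ! Suc l}" using endsi[OF l] by blast
    qed (use that in auto)
    have c1: "conn H ?Y (ws ! 0) x" if "x \<in> set vs" for x
      using c0 that w(2) k by (metis in_set_conv_nth less_Suc_eq_le)
    have c2: "conn H ?Y (ws ! 0) x" if "x \<in> verts H" for x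
    proof (cases "x = p")
      case True
      have "conn H ?Y p r" using conn_edge s(2) by (metis insertI1)
      then show ?thesis using c1[OF s(3)] True conn_trans conn_sym by metis
    next
      case False
      then show ?thesis using c1 that V by blast
    qed
    then show "conn H ?Y x y" if "x \<in> verts H" "y \<in> verts H" for x y
      using that conn_trans conn_sym by metis
  qed
qed

text \<open>Both cycles are rotated to start at the attachment vertex of the pendant edge; positions
  are then matched, and pendant vertex and edge are sent to their counterparts.\<close>

lemma cyc_pendant_isomorphic:
  assumes 1: "cyc H vs es" "verts H = insert p (set vs)" "p \<notin> set vs"
      "edges H = insert s (set es)" "s \<notin> set es" "ends H s = {p, r}" "r \<in> set vs"
    and 2: "cyc K ws ds" "verts K = insert q (set ws)" "q \<notin> set ws"
      "edges K = insert t (set ds)" "t \<notin> set ds" "ends K t = {q, v}" "v \<in> set ws"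
    and l: "length vs = length ws"
  shows "graph_isomorphic H K"
proof -
  obtain vs' es' where v: "cyc H vs' es'" "set vs' = set vs" "set es' = set es" "vs' ! 0 = r"
    using cyc_starting_at_vertex[OF 1(1) 1(7)] by blast
  obtain ws' ds' where w: "cyc K ws' ds'" "set ws' = set ws" "set ds' = set ds" "ws' ! 0 = v"
    using cyc_starting_at_vertex[OF 2(1) 2(7)] by blast
  define k where "k = length vs'"
  have dv: "distinct vs'" "distinct es'" "distinct ws'" "distinct ds'" using v w by (auto simp: cyc_def)
  have k: "length vs' = k" "length es' = k" "k \<ge> 2" "length ws' = k" "length ds' = k"
    using v w l 1(1) 2(1) unfolding cyc_def k_def by (metis distinct_card)+
  \<comment> \<open>Polymorphic because it serves both vertices and edges: \<open>x\<close> and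
    \<open>y\<close> stand for the pendant items, the lists for the cycles.\<close>
  have bij: "\<exists>f. bij_betw f (insert x (set xs)) (insert y (set ys)) \<and> f x = y \<and> (\<forall>i<k. f (xs ! i) = ys ! i)"
    if h: "distinct xs" "distinct ys" "length xs = k" "length ys = k" "x \<notin> set xs" "y \<notin> set ys"
    for x :: 'x and xs and y :: 'y and ys
  proof -
    define f where "f = the \<circ> (map_of (zip (x # xs) (y # ys)))"
    have f: "f ((x # xs) ! i) = (y # ys) ! i" if "i < Suc k" for i
      using that h
      unfolding f_def by (subst o_apply, subst map_of_zip_nth) auto
    have "bij_betw f (set (x # xs)) (set (y # ys))"
      unfolding bij_betw_def
    proof
      show "inj_on f (set (x # xs))"
        unfolding inj_on_def
      proof (intro ballI impI)
        fix a b assume "a \<in> set (x # xs)" "b \<in> set (x # xs)" and eq: "f a = f b"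
        then obtain i j where ij: "i < Suc k" "j < Suc k" "a = (x # xs) ! i" "b = (x # xs) ! j"
          using h(3) by (metis in_set_conv_nth length_Cons)
        then have "(y # ys) ! i = (y # ys) ! j" using f eq by metis
        moreover have "distinct (y # ys)" using h by simp
        ultimately have "i = j" using ij h(4) by (metis length_Cons nth_eq_iff_index_eq)
        then show "a = b" using ij by simp
      qed
      have "map f (x # xs) = y # ys"
      proof (rule nth_equalityI)
        show "length (map f (x # xs)) = length (y # ys)" using h by simp
        show "map f (x # xs) ! i = (y # ys) ! i" if "i < length (map f (x # xs))" for i
          using f[of i] that h(3) nth_map[of i "x # xs" f] by simp
      qed
      then show "f ` set (x # xs) = set (y # ys)" by (metis list.set_map)
    qed
    moreover have "f x = y" using f[of 0] by simp
    moreover have "f (xs ! i) = ys ! i" if "i < k" for i using f[of "Suc i"] that by simp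
    ultimately show ?thesis by auto
  qed
  obtain f where f: "bij_betw f (insert p (set vs')) (insert q (set ws'))" "f p = q" "\<forall>i<k. f (vs' ! i) = ws' ! i"
    using bij[of vs' ws' p q] dv k v w 1 2 by auto
  obtain g where g: "bij_betw g (insert s (set es')) (insert t (set ds'))" "g s = t" "\<forall>i<k. g (es' ! i) = ds' ! i"
    using bij[of es' ds' s t] dv k v w 1 2 by auto
  have "ends K (g e) = f ` ends H e" if e: "e \<in> edges H" for e
  proof (cases "e = s")
    case True
    have "f r = v" using f(3) k v(4) w(4) by force
    then show ?thesis using True g(2) f(2) 1(6) 2(6) by simp
  next
    case False
    then have "e \<in> set es'" using e 1(4) v by blast
    then obtain i where i: "i < k" "e = es' ! i" using k by (metis in_set_conv_nth)
    \<comment> \<open>The reduced index stays in range, so \<open>f\<close> also matches the ends of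
      the closing edge.\<close>
    have m: "Suc i mod k < k" using k by simp
    have "ends H e = {vs' ! i, vs' ! (Suc i mod k)}" "ends K (g e) = {ws' ! i, ws' ! (Suc i mod k)}"
      using v(1) w(1) k i g(3) by (auto simp: cyc_def)
    then show ?thesis using f(3) i m by simp
  qed
  then show ?thesis
    unfolding graph_isomorphic_def using f(1) g(1) v w 1 2 by metis
qed

section \<open>Uniform matroids and the truncation for a cycle with a pendant edge\<close>

lemma matroid_isomorphic_uniform:
  assumes "finite (ground M)" "bases M = {B. B \<subseteq> ground M \<and> card B = k}"
  shows "matroid_isomorphic M (uniform_matroid k (card (ground M)))"
proof -
  obtain f where f: "bij_betw f (ground M) {..<card (ground M)}"
    using ex_bij_betw_finite_nat[OF assms(1)] by (auto simp: atLeast0LessThan)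
  have "B \<in> bases M \<longleftrightarrow> f ` B \<in> bases (uniform_matroid k (card (ground M)))" if "B \<subseteq> ground M" for B
  proof -
    have "card (f ` B) = card B"
      using f that by (meson bij_betw_imp_inj_on card_image inj_on_subset)
    moreover have "f ` B \<subseteq> {..<card (ground M)}"
      using f that by (metis bij_betw_imp_surj_on image_mono)
    ultimately show ?thesis using assms(2) that by (simp add: uniform_matroid_def)
  qed
  then show ?thesis
    using f unfolding matroid_isomorphic_def by (auto simp: uniform_matroid_def)
qed

text \<open>A basis of the cycle matroid omits exactly one edge, on the cycle; truncation omits one
  more. Every pair of omitted edges arises, since at most one of the two is
  \<open>s\<close>.\<close>

lemma truncation_cyc_pendant:
  assumes H: "graph H" and c: "cyc H vs es"
    and V: "verts H = insert p (set vs)" "p \<notin> set vs"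
    and s: "edges H = insert s (set es)" "s \<notin> set es" "ends H s = {p, r}" "r \<in> set vs"
  shows "bases (truncation (cycle_matroid H)) =
    {B. B \<subseteq> edges H \<and> card B = card (edges H) - 2}"
proof -
  let ?X = "set es"
  have ba: "basis H (insert s (?X - {z}))" if "z \<in> ?X" for z
    using cyc_pendant_basis[OF H c that V _ s(3,4)] s(1) by blast
  have ba': "\<exists>z\<in>?X. B = insert s (?X - {z})" if "basis H B" for B
  proof -
    have B: "acyc H B" "B \<subseteq> insert s ?X"
      using that s(1) by (auto simp: basis_def acyc_def)
    \<comment> \<open>A basis misses some cycle edge \<open>z\<close>, hence lies in one of the
      known bases and equals it by maximality.\<close>
    then have "\<not> ?X \<subseteq> B" using c by (auto simp: acyc_def)
    then obtain z where z: "z \<in> ?X" "z \<notin> B" by blast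
    then have "B \<subseteq> insert s (?X - {z})" using B by blast
    then have "insert s (?X - {z}) = B"
      using that ba[OF z(1)] unfolding basis_def by blast
    then show ?thesis using z by blast
  qed
  have cE: "card (edges H) = Suc (card ?X)" using s by simp
  have sub: "B \<subseteq> edges H \<and> card B = card (edges H) - 2"
    if "basis H A" "x \<in> A" "B = A - {x}" for A B x
  proof -
    obtain z where z: "z \<in> ?X" "A = insert s (?X - {z})" using ba' \<open>basis H A\<close> by blast
    have "card A = card ?X"
      using z s(2) card_Suc_Diff1[of ?X z] by simp
    then show ?thesis using that z s(1) cE by auto
  qed
  have sup: "\<exists>A x. B = A - {x} \<and> basis H A \<and> x \<in> A"
    if B: "B \<subseteq> edges H" "card B = card (edges H) - 2" for B
  proof -
    \<comment> \<open>Guarantees that the natural-number subtraction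
      \<open>card (edges H) - 2\<close> is exact.\<close>
    have "card ?X \<ge> 2" using c by (simp add: cyc_def distinct_card)
    moreover have "finite B" using B(1) s(1) finite_subset by fastforce
    ultimately have "card (edges H - B) = 2"
      using B cE by (simp add: card_Diff_subset)
    then obtain y z where yz: "edges H - B = {y, z}" "y \<noteq> z" by (auto simp: card_2_iff)
    \<comment> \<open>The omitted cycle edge \<open>z\<close> determines the basis, and
      \<open>y\<close> is the element removed by truncation; the roles are swapped below if
      \<open>z\<close> is \<open>s\<close>.\<close>
    have *: "\<exists>A x. B = A - {x} \<and> basis H A \<and> x \<in> A"
      if "edges H - B = {y, z}" "y \<noteq> z" "z \<noteq> s" for y z
    proof -
      have "z \<in> ?X" using that s(1) by blast
      moreover have "B = insert s (?X - {z}) - {y}"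
      proof -
        have "B = edges H - {y, z}" using that(1) B(1) by blast
        then show ?thesis using that s(1) by blast
      qed
      moreover have "y \<in> insert s (?X - {z})" using that s(1) by blast
      ultimately show ?thesis using ba by blast
    qed
    show ?thesis
    proof (cases "z = s")
      case True
      then show ?thesis using *[of z y] yz by (simp add: insert_commute)
    next
      case False
      then show ?thesis using *[of y z] yz by simp
    qed
  qed
  show ?thesis
    unfolding bases_truncation[OF H]
  proof (intro set_eqI iffI)
    fix B assume "B \<in> {A - {x} |A x. basis H A \<and> x \<in> A}"
    then obtain A x where "basis H A" "x \<in> A" "B = A - {x}" by auto
    then show "B \<in> {B. B \<subseteq> edges H \<and> card B = card (edges H) - 2}"
      using sub[of A x B] by simp
  next
    fix B assume "B \<in> {B. B \<subseteq> edges H \<and> card B = card (edges H) - 2}"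
    then show "B \<in> {A - {x} |A x. basis H A \<and> x \<in> A}"
      using sup[of B] by simp
  qed
qed

section \<open>Transfer between \<open>G\<close> and \<open>F\<close> through the common
  truncation\<close>

theorem claim3p8:
  fixes G :: "('v, 'e) ugraph" and F :: "('w, 'e) ugraph"
    and E X :: "'e set" and R :: "('v, 'e) ugraph" and c r :: 'v and s :: 'e
  assumes "simple_graph G" and "connected_graph G"
    and "simple_graph F" and "connected_graph F"
    and "edges G = E" and "edges F = E"
    and "truncation (cycle_matroid G) = truncation (cycle_matroid F)"
    and "cycle_matroid G \<noteq> cycle_matroid F"
    and "X \<subseteq> E"
    and "R = edge_subgraph G X"
    and "quasi_hamiltonian R G"
    and "spanning_tree (edge_subgraph F X) F"
    and "verts G - verts R = {c}"
    and "{e \<in> edges G. c \<in> ends G e} = {s}"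
    and "ends G s = {c, r}" and "r \<in> verts R"
  shows "(graph_isomorphic F G \<or> cycle_graph F) \<and>
    matroid_isomorphic (truncation (cycle_matroid G)) (uniform_matroid (card E - 2) (card E)) \<and>
    bases (truncation (cycle_matroid G)) = {B. B \<subseteq> E \<and> card B = card E - 2}"
proof -
  have gG: "graph G" and gF: "graph F"
    using assms(1,3) by (auto simp: simple_graph_def)
  have "subgraph R G" "cycle_graph R"
    using assms(11) by (auto simp: quasi_hamiltonian_def)
  then obtain vs es where "cyc G vs es" "edges R = set es" "verts R = set vs"
    using cycle_graph_cyc by blast
  then have C: "cyc G vs es" and X: "X = set es" and VR: "verts R = set vs"
    using assms(10) by (auto simp: edge_subgraph_def)
  have VG: "verts G = insert c (set vs)" "c \<notin> set vs"
    using \<open>subgraph R G\<close> assms(13) VR by (auto simp: subgraph_def)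
  have rR: "r \<in> set vs" using assms(16) VR by simp
  have sE: "s \<in> E" using assms(5,14) by blast
  have sX: "s \<notin> X"
  proof
    assume "s \<in> X"
    then have "c \<in> verts R" using assms(10,15) by (auto simp: edge_subgraph_def)
    then show False using VR VG by simp
  qed
  have st: "subgraph (edge_subgraph F X) F" "forest (edge_subgraph F X)"
      "connected_graph (edge_subgraph F X)" "verts (edge_subgraph F X) = verts F"
    using assms(12) by (auto simp: spanning_tree_def tree_def)
  have aX: "acyc F X"
    using forest_iff_acyc[OF st(1) gF] st(2) by (simp add: edge_subgraph_def)
  have cX: "conn F X u v" if "u \<in> verts F" "v \<in> verts F" for u v
  proof -
    have "edges (edge_subgraph F X) = X" "ends (edge_subgraph F X) = ends F"
      by (simp_all add: edge_subgraph_def)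
    then show ?thesis
      using st(3) that unfolding connected_graph_def conn_def adj_def st(4) by simp
  qed
  have VF: "verts F = (\<Union>e\<in>X. ends F e)"
    using st(4) by (simp add: edge_subgraph_def)

  have EX: "E = insert s X"
  proof (rule ccontr)
    assume "E \<noteq> insert s X"
    then obtain e where e: "e \<in> E" "e \<noteq> s" "e \<notin> X" using sE assms(9) by blast
    \<comment> \<open>As \<open>s\<close> is the only spoke, the edge \<open>e\<close> has both ends
      on the cycle and is a chord.\<close>
    have "c \<notin> ends G e" using e assms(5,14) by blast
    moreover have "ends G e \<subseteq> verts G" using gG e assms(5) by (auto simp: graph_def)
    ultimately have eV: "ends G e \<subseteq> set vs" using VG by auto
    obtain f where f: "f \<in> X" "basis F (insert e (X - {f}))"
      using spanning_tree_exchange[OF gF aX cX] e assms(6) by blast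
    obtain x where x: "x \<in> X - {f}" "\<not> acyc G (insert e (X - {f, x}))"
      using cyc_chord[OF assms(1) C _ _ _ eV] f(1) e assms(5) X by blast
    \<comment> \<open>Deleting \<open>x\<close> from the exchanged basis of \<open>F\<close> gives a
      basis of the common truncation, although the set contains a cycle of \<open>G\<close>.\<close>
    have "insert e (X - {f}) - {x} \<in> bases (truncation (cycle_matroid F))"
      unfolding bases_truncation[OF gF] using f x by blast
    moreover have "insert e (X - {f}) - {x} = insert e (X - {f, x})" using x e by blast
    ultimately show False
      using x acyc_truncation[OF gG] assms(7) by metis
  qed
  have bG: "bases (truncation (cycle_matroid G)) = {B. B \<subseteq> E \<and> card B = card E - 2}"
    using truncation_cyc_pendant[OF gG C VG _ _ assms(15) rR] EX sX X assms(5) by simp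
  have finE: "finite E" using gG assms(5) by (simp add: graph_def)
  have gr: "ground (truncation (cycle_matroid G)) = E"
    using assms(5) by (simp add: truncation_def cycle_matroid_def)
  have iso: "matroid_isomorphic (truncation (cycle_matroid G)) (uniform_matroid (card E - 2) (card E))"
    using matroid_isomorphic_uniform[of "truncation (cycle_matroid G)" "card E - 2"] bG gr finE by simp

  \<comment> \<open>Complements of pairs are bases of the truncation, hence acyclic in
    \<open>F\<close>: a cycle of \<open>F\<close> misses at most one edge.\<close>
  have aF: "acyc F (E - D)" if "D \<subseteq> E" "card D = 2" for D
  proof -
    have "card (E - D) = card E - 2" using that finE by (simp add: card_Diff_subset finite_subset)
    then show ?thesis using acyc_truncation[OF gF] bG assms(7) by auto
  qed
  \<comment> \<open>The ends of \<open>s\<close> are already connected through the spanning tree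
    \<open>X\<close>, so \<open>s\<close> is not a bridge of \<open>E\<close>.\<close>
  have "\<not> acyc F E"
  proof
    assume a: "acyc F E"
    obtain u v where uv: "ends F s = {u, v}" "u \<in> verts F" "v \<in> verts F"
      using graph_ends[OF gF] sE assms(6) by metis
    have "E - {s} = X" using EX sX by blast
    then show False using acyc_not_conn[OF gF a sE uv(1)] cX uv by simp
  qed
  then obtain ws ds where D: "cyc F ws ds" "set ds \<subseteq> E"
    using assms(6) by (auto simp: acyc_def)
  have subF: "set ws \<subseteq> verts F" "\<And>e. e \<in> set ds \<Longrightarrow> ends F e \<subseteq> set ws"
    using cyc_cycle_graph(1)[OF gF D(1)] by (auto simp: subgraph_def graph_def)
  have "card (E - set ds) < 2"
  proof (rule ccontr)
    assume "\<not> card (E - set ds) < 2"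
    then obtain A where A: "A \<subseteq> E - set ds" "card A = 2"
      by (metis not_less obtain_subset_with_card_n)
    then have "acyc F (E - A)" using aF by blast
    moreover have "set ds \<subseteq> E - A" using A D by blast
    ultimately show False using D(1) unfolding acyc_def by blast
  qed
  then consider "E - set ds = {}" | "card (E - set ds) = 1"
    using finE by (metis One_nat_def card_0_eq finite_Diff less_2_cases_iff)
  then have "graph_isomorphic F G \<or> cycle_graph F"
  proof cases
    case 1
    then have "set ds = E" using D by blast
    \<comment> \<open>Every vertex of \<open>F\<close> meets an edge of the spanning tree
      \<open>X\<close>, and all these edges lie on the cycle.\<close>
    moreover from this have "verts F = set ws" using VF subF assms(9) by blast
    ultimately have "cycle_graph F"
      using D(1) assms(6) unfolding cycle_graph_def cyc_def by metis
    then show ?thesis ..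
  next
    case 2
    then obtain y where "E - set ds = {y}" by (auto simp: card_1_singleton_iff)
    then have y: "E = insert y (set ds)" "y \<notin> set ds" using D by auto
    obtain a b where ab: "ends F y = {a, b}" "a \<noteq> b" "a \<in> verts F" "b \<in> verts F"
      using graph_ends[OF gF] y assms(6) by blast
    have "0 < length ws" using D(1) by (auto simp: cyc_def)
    then have w0: "ws ! 0 \<in> set ws" by simp
    have "\<not> ends F y \<subseteq> set ws"
    proof
      assume yw: "ends F y \<subseteq> set ws"
      \<comment> \<open>Any cycle edge serves as \<open>f\<close> here: if \<open>y\<close> were a
        chord, \<open>cyc_chord\<close> would give a cycle of \<open>F\<close> missing two
        edges.\<close>
      have f: "ds ! 0 \<in> set ds"
        using D(1) \<open>0 < length ws\<close> by (metis cyc_def nth_mem)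
      obtain x where x: "x \<in> set ds - {ds ! 0}" "\<not> acyc F (insert y (set ds - {ds ! 0, x}))"
        using cyc_chord[OF assms(3) D(1) f _ y(2) yw] y(1) assms(6) by blast
      have "insert y (set ds - {ds ! 0, x}) = E - {ds ! 0, x}" using y x f by blast
      moreover have "card {ds ! 0, x} = 2" using x by auto
      moreover have "{ds ! 0, x} \<subseteq> E" using x f D by auto
      ultimately show False using x aF by metis
    qed
    moreover have "ends F y \<inter> set ws \<noteq> {}"
    proof
      \<comment> \<open>Then no edge would leave the vertex set of the cycle, against the connection
        through \<open>X\<close> to the end \<open>a\<close> of \<open>y\<close>.\<close>
      assume d: "ends F y \<inter> set ws = {}"
      have "a \<in> set ws"
      proof (rule conn_closed)
        show "conn F X (ws ! 0) a" using cX w0 subF ab by blast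
        show "ends F e \<subseteq> set ws \<or> ends F e \<inter> set ws = {}" if "e \<in> X" for e
          using that assms(9) y subF d by blast
      qed (rule w0)
      then show False using ab d by blast
    qed
    ultimately have "a \<notin> set ws \<and> b \<in> set ws \<or> b \<notin> set ws \<and> a \<in> set ws"
      using ab(1) by auto
    then obtain p q where pq: "ends F y = {p, q}" "p \<notin> set ws" "q \<in> set ws"
      using ab(1) by (metis insert_commute)
    have VF': "verts F = insert p (set ws)"
    proof
      show "verts F \<subseteq> insert p (set ws)"
        using VF subF(2) y pq assms(9) by blast
      show "insert p (set ws) \<subseteq> verts F"
        using subF(1) ab pq(1) by (simp add: doubleton_eq_iff) auto
    qed
    \<comment> \<open>Both cycles consist of all edges but one, so they have equal length.\<close>
    have "Suc (card (set ds)) = card E"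
      unfolding y(1) using y(2) by simp
    moreover have "Suc (card (set es)) = card E"
      unfolding EX X using sX X by simp
    ultimately have "length ws = length vs"
      using D(1) C by (simp add: cyc_def distinct_card)
    then have "graph_isomorphic F G"
      using cyc_pendant_isomorphic[OF D(1) VF' pq(2) _ y(2) pq(1,3) C VG _ _ assms(15) rR]
        y(1) EX sX X assms(5,6) by blast
    then show ?thesis ..
  qed
  then show ?thesis using bG iso by blast
qed

end
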